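(* Let $G=(V,E)$ be a graph and $A_s,A_t\subseteq V$ independent offensive alliances with $|A_s|=|A_t|=k$. There is an independent offensive alliance TJ sequence from $A_s$ to $A_t$ if and only if there is an independent offensive alliance TAR sequence from $A_s$ to $A_t$ with threshold $k+1$.
   Context: For $A\subseteq V$: $\partial A=N(A)\setminus A$, $d_A(v)=|N(v)\cap A|$; $A$ is an offensive alliance if $d_A(v)\ge d_{V\setminus A}(v)+1$ for all $v\in\partial A$, and an independent offensive alliance if additionally it is an independent set. $B$ is obtained from $A$ by a token jumping (TJ) step if $|A|=|B|$ and $|A\setminus B|=1$; by a token addition/removal (TAR) step if one of $A,B$ arises from the other by adding exactly one vertex. An independent offensive alliance $Y$ sequence ($Y\in\{\text{TJ},\text{TAR}\}$) is a sequence $A_1,\dots,A_m$ of independent offensive alliances where each $A_{i+1}$ is obtained from $A_i$ by a $Y$ step; a TAR sequence has threshold $t$ if all its sets have size at most $t$. *)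

theory Defs
  imports Main
begin

text \<open>Graphs are finite, simple and undirected, given by a vertex set \<open>V\<close> and a set \<open>E\<close> of
  two-element subsets of \<open>V\<close>.\<close>

definition finite_simple_graph :: "'a set \<Rightarrow> 'a set set \<Rightarrow> bool" where
  "finite_simple_graph V E \<longleftrightarrow> finite V \<and> (\<forall>e\<in>E. e \<subseteq> V \<and> card e = 2)"

definition nbhd :: "'a set set \<Rightarrow> 'a \<Rightarrow> 'a set" where
  "nbhd E v = {u. {u, v} \<in> E}"

definition set_nbhd :: "'a set set \<Rightarrow> 'a set \<Rightarrow> 'a set" where
  "set_nbhd E A = (\<Union>v\<in>A. nbhd E v)"

definition boundary :: "'a set set \<Rightarrow> 'a set \<Rightarrow> 'a set" where
  "boundary E A = set_nbhd E A - A"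

definition deg_in :: "'a set set \<Rightarrow> 'a set \<Rightarrow> 'a \<Rightarrow> nat" where
  "deg_in E A v = card (nbhd E v \<inter> A)"

text \<open>The empty set is not excluded.\<close>

definition offensive_alliance :: "'a set \<Rightarrow> 'a set set \<Rightarrow> 'a set \<Rightarrow> bool" where
  "offensive_alliance V E A \<longleftrightarrow>
     A \<subseteq> V \<and> (\<forall>v\<in>boundary E A. deg_in E A v \<ge> deg_in E (V - A) v + 1)"

definition independent_set :: "'a set \<Rightarrow> 'a set set \<Rightarrow> 'a set \<Rightarrow> bool" where
  "independent_set V E A \<longleftrightarrow> A \<subseteq> V \<and> (\<forall>u\<in>A. \<forall>v\<in>A. {u, v} \<notin> E)"

definition indep_offensive_alliance :: "'a set \<Rightarrow> 'a set set \<Rightarrow> 'a set \<Rightarrow> bool" where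
  "indep_offensive_alliance V E A \<longleftrightarrow> offensive_alliance V E A \<and> independent_set V E A"

definition TJ_step :: "'a set \<Rightarrow> 'a set \<Rightarrow> bool" where
  "TJ_step A B \<longleftrightarrow> card A = card B \<and> card (A - B) = 1"

definition TAR_step :: "'a set \<Rightarrow> 'a set \<Rightarrow> bool" where
  "TAR_step A B \<longleftrightarrow> (\<exists>v. v \<notin> A \<and> B = insert v A) \<or> (\<exists>v. v \<notin> B \<and> A = insert v B)"

text \<open>A sequence \<open>A\<^sub>1, \<dots>, A\<^sub>m\<close> is a list with \<open>m \<ge> 1\<close>; the one-element sequence
  (no steps) is allowed.\<close>

definition ioa_sequence ::
  "('a set \<Rightarrow> 'a set \<Rightarrow> bool) \<Rightarrow> 'a set \<Rightarrow> 'a set set \<Rightarrow> 'a set list \<Rightarrow> bool" where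
  "ioa_sequence step V E As \<longleftrightarrow>
     As \<noteq> [] \<and> (\<forall>A\<in>set As. indep_offensive_alliance V E A) \<and>
     (\<forall>i. Suc i < length As \<longrightarrow> step (As ! i) (As ! Suc i))"

definition has_threshold :: "nat \<Rightarrow> 'a set list \<Rightarrow> bool" where
  "has_threshold t As \<longleftrightarrow> (\<forall>A\<in>set As. card A \<le> t)"

definition from_to :: "'a set \<Rightarrow> 'a set \<Rightarrow> 'a set list \<Rightarrow> bool" where
  "from_to A B As \<longleftrightarrow> hd As = A \<and> last As = B"

end

theory Submission
  imports Defs
begin

text \<open>The union of two independent offensive alliances is an offensive alliance, so a jump from
  \<open>C \<union> {a}\<close> to \<open>C \<union> {b}\<close> can pass through \<open>C \<union> {a, b}\<close> unless \<open>a\<close> and \<open>b\<close> are adjacent. In that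
  case \<open>{a, b}\<close> is a connected component, and the jump can pass through \<open>C\<close> instead.

  Conversely, follow a TAR sequence and keep, for its current set \<open>B\<close> with at most \<open>k\<close> vertices,
  a set \<open>T\<close> of size \<open>k\<close> that is reachable by jumps and that arises from \<open>B\<close> by additions alone.
  If \<open>B\<close> gains a vertex \<open>b\<close>, then \<open>b\<close> is added to all sets between \<open>B\<close> and \<open>T\<close>. This stops when
  a set already contains \<open>b\<close>, when a set contains the only neighbour of \<open>b\<close> (which is then
  exchanged for \<open>b\<close> from there on), or just below \<open>T\<close>; each time the top set changes by at most
  one jump.\<close>

text \<open>Turns sequences into reachability, so that later inductions need no lists. The separate
  \<open>Q a\<close> is needed for the one-element list, where the closure says nothing about
  \<open>a\<close>.\<close>

lemma ex_list_successively_iff_rtranclp: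
  "(\<exists>xs. xs \<noteq> [] \<and> hd xs = a \<and> last xs = b \<and> (\<forall>x\<in>set xs. Q x) \<and> successively R xs) \<longleftrightarrow>
   Q a \<and> (\<lambda>x y. Q x \<and> Q y \<and> R x y)\<^sup>*\<^sup>* a b" (is "?L \<longleftrightarrow> ?R")
proof
  assume ?L
  then obtain xs where "xs \<noteq> []" "hd xs = a" "last xs = b" "\<forall>x\<in>set xs. Q x" "successively R xs"
    by blast
  then show ?R
  proof (induction xs arbitrary: a rule: induct_list012)
    case (3 x y zs)
    then have "(\<lambda>x y. Q x \<and> Q y \<and> R x y)\<^sup>*\<^sup>* y b" and "Q x \<and> Q y \<and> R x y" by auto
    with 3 show ?case by (auto intro: converse_rtranclp_into_rtranclp)
  qed auto
next
  assume ?R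
  then have "(\<lambda>x y. Q x \<and> Q y \<and> R x y)\<^sup>*\<^sup>* a b" "Q a" by auto
  then show ?L
  proof (induction rule: converse_rtranclp_induct)
    case base
    then show ?case by (intro exI[of _ "[b]"]) auto
  next
    case (step y z)
    then obtain xs where "xs \<noteq> []" "hd xs = z" "last xs = b" "\<forall>x\<in>set xs. Q x" "successively R xs"
      by blast
    with step show ?case by (intro exI[of _ "y # xs"]) (auto simp: successively_Cons)
  qed
qed

lemma nbhd_sym: "u \<in> nbhd E v \<longleftrightarrow> v \<in> nbhd E u"
  by (simp add: nbhd_def insert_commute)

lemma in_boundary_iff: "v \<in> boundary E A \<longleftrightarrow> v \<notin> A \<and> nbhd E v \<inter> A \<noteq> {}"
  by (auto simp: boundary_def set_nbhd_def nbhd_sym[of v])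

lemma indep_offensive_alliance_iff:
  "indep_offensive_alliance V E A \<longleftrightarrow>
     A \<subseteq> V \<and> (\<forall>v\<in>A. nbhd E v \<inter> A = {}) \<and>
     (\<forall>v. v \<notin> A \<longrightarrow> nbhd E v \<inter> A \<noteq> {} \<longrightarrow> card (nbhd E v \<inter> (V - A)) < card (nbhd E v \<inter> A))"
  unfolding indep_offensive_alliance_def offensive_alliance_def independent_set_def
    Ball_def in_boundary_iff deg_in_def
  by (auto simp: nbhd_def Suc_le_eq)

locale fin_graph =
  fixes V :: "'a set" and E :: "'a set set"
  assumes graph: "finite_simple_graph V E"
begin

abbreviation "ioa \<equiv> indep_offensive_alliance V E"
abbreviation "N \<equiv> nbhd E"

lemma finite_V: "finite V" and N_subset: "N v \<subseteq> V" and N_irrefl: "v \<notin> N v"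
  using graph by (auto simp: finite_simple_graph_def nbhd_def)

lemma finite_N: "finite (N v)"
  using finite_V N_subset finite_subset by blast

lemma ioa_finite: "ioa A \<Longrightarrow> finite A"
  using finite_V finite_subset unfolding indep_offensive_alliance_iff by blast

section \<open>Unions of alliances and single-edge components\<close>

definition K2_component :: "'a \<Rightarrow> 'a \<Rightarrow> bool" where
  "K2_component a b \<longleftrightarrow> N a = {b} \<and> N b = {a}"

lemma K2_component_sym: "K2_component a b \<Longrightarrow> K2_component b a"
  by (simp add: K2_component_def)

lemma degree_mono:
  assumes "A \<subseteq> C" "card (N v \<inter> (V - A)) < card (N v \<inter> A)"
  shows "card (N v \<inter> (V - C)) < card (N v \<inter> C)"
proof -
  have "card (N v \<inter> (V - C)) \<le> card (N v \<inter> (V - A))"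
    using assms(1) finite_N by (intro card_mono) auto
  moreover have "card (N v \<inter> A) \<le> card (N v \<inter> C)"
    using assms(1) finite_N by (intro card_mono) auto
  ultimately show ?thesis using assms(2) by linarith
qed

text \<open>A boundary vertex of the union is a boundary vertex of \<open>A\<close> or of
  \<open>B\<close>, and enlarging that set only moves neighbours to the favourable side. Only
  independence can fail, hence the third assumption.\<close>

lemma ioa_Un:
  assumes "ioa A" "ioa B" "\<forall>v\<in>A \<union> B. N v \<inter> (A \<union> B) = {}"
  shows "ioa (A \<union> B)"
  unfolding indep_offensive_alliance_iff
proof (intro conjI allI impI)
  show "A \<union> B \<subseteq> V" using assms(1,2) by (simp add: indep_offensive_alliance_iff)
  fix v assume v: "v \<notin> A \<union> B" "N v \<inter> (A \<union> B) \<noteq> {}"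
  then have "N v \<inter> A \<noteq> {} \<or> N v \<inter> B \<noteq> {}" by blast
  then show "card (N v \<inter> (V - (A \<union> B))) < card (N v \<inter> (A \<union> B))"
  proof
    assume "N v \<inter> A \<noteq> {}"
    then have "card (N v \<inter> (V - A)) < card (N v \<inter> A)"
      using assms(1) v(1) by (simp add: indep_offensive_alliance_iff)
    then show ?thesis by (rule degree_mono[rotated]) simp
  next
    assume "N v \<inter> B \<noteq> {}"
    then have "card (N v \<inter> (V - B)) < card (N v \<inter> B)"
      using assms(2) v(1) by (simp add: indep_offensive_alliance_iff)
    then show ?thesis by (rule degree_mono[rotated]) simp
  qed
qed (fact assms(3))

text \<open>Independence of \<open>insert b C\<close> leaves \<open>a\<close> as the only neighbour
  of \<open>b\<close> in \<open>insert a C\<close>. Since \<open>b\<close> is a boundary vertex of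
  that alliance, it has fewer than one neighbour outside.\<close>

lemma N_eq_singleton:
  assumes "ioa (insert a C)" "ioa (insert b C)" "b \<in> N a" "b \<notin> C"
  shows "N b = {a}"
proof -
  have "a \<in> N b" and "b \<noteq> a" using assms(3) nbhd_sym N_irrefl by metis+
  have "N b \<inter> C = {}" using assms(2) by (auto simp: indep_offensive_alliance_iff)
  then have eq: "N b \<inter> insert a C = {a}" using \<open>a \<in> N b\<close> by blast
  moreover have "b \<notin> insert a C" using assms(4) \<open>b \<noteq> a\<close> by blast
  ultimately have "card (N b \<inter> (V - insert a C)) < 1"
    using assms(1) unfolding indep_offensive_alliance_iff
    by (metis card.empty card_insert_disjoint empty_iff finite.emptyI insert_not_empty One_nat_def)
  then have "N b \<inter> (V - insert a C) = {}" using finite_N by auto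
  then show ?thesis using eq N_subset by blast
qed

lemma ioa_insert2_or_K2:
  assumes "ioa (insert a C)" "ioa (insert b C)" "a \<notin> C" "b \<notin> C"
  shows "ioa (insert a (insert b C)) \<or> K2_component a b"
proof (cases "b \<in> N a")
  case True
  then show ?thesis
    using N_eq_singleton[OF assms(1,2) _ assms(4)] N_eq_singleton[OF assms(2,1) _ assms(3)] nbhd_sym
    unfolding K2_component_def by metis
next
  case False
  then have "a \<notin> N b" using nbhd_sym by metis
  with assms False have "ioa (insert a C \<union> insert b C)"
    by (intro ioa_Un) (auto simp: indep_offensive_alliance_iff N_irrefl)
  then show ?thesis by (simp add: insert_commute)
qed

text \<open>Only \<open>b\<close> is adjacent to \<open>a\<close>, and \<open>b\<close> has no
  neighbour in \<open>C\<close>, so the counts at all boundary vertices of \<open>C\<close> stay the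
  same.\<close>

lemma ioa_remove_K2:
  assumes "ioa (insert a C)" "K2_component a b" "a \<notin> C"
  shows "ioa C"
  unfolding indep_offensive_alliance_iff
proof (intro conjI allI impI)
  show "C \<subseteq> V" "\<forall>v\<in>C. N v \<inter> C = {}" using assms(1) by (auto simp: indep_offensive_alliance_iff)
  fix v assume v: "v \<notin> C" "N v \<inter> C \<noteq> {}"
  have "b \<notin> C" using assms(1,2) by (auto simp: indep_offensive_alliance_iff K2_component_def)
  then have "v \<noteq> a" "v \<noteq> b" using v assms(2,3) by (auto simp: K2_component_def)
  then have "a \<notin> N v" using assms(2) nbhd_sym[of a E v] by (auto simp: K2_component_def)
  then have "N v \<inter> insert a C = N v \<inter> C" "N v \<inter> (V - insert a C) = N v \<inter> (V - C)" by auto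
  then show "card (N v \<inter> (V - C)) < card (N v \<inter> C)"
    using assms(1) v \<open>v \<noteq> a\<close> unfolding indep_offensive_alliance_iff by metis
qed

text \<open>The only possible new boundary vertex is \<open>b\<close>, whose whole neighbourhood
  \<open>{a}\<close> now lies inside.\<close>

lemma ioa_insert_K2:
  assumes "ioa C" "K2_component a b" "b \<notin> C"
  shows "ioa (insert a C)"
  unfolding indep_offensive_alliance_iff
proof (intro conjI allI impI)
  have "a \<in> V" using assms(2) N_subset by (auto simp: K2_component_def)
  then show "insert a C \<subseteq> V" using assms(1) by (auto simp: indep_offensive_alliance_iff)
  have N_a: "a \<notin> N v" if "v \<noteq> b" for v
    using assms(2) nbhd_sym[of a E v] that by (auto simp: K2_component_def)
  show "\<forall>v\<in>insert a C. N v \<inter> insert a C = {}"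
  proof -
    have "a \<notin> N v" if "v \<in> insert a C" for v
      using N_a assms(3) N_irrefl that by (metis insertE)
    moreover have "N a = {b}" "b \<noteq> a" using assms(2) N_irrefl[of a] by (auto simp: K2_component_def)
    ultimately show ?thesis using assms(1,3) unfolding indep_offensive_alliance_iff by auto
  qed
  fix v assume v: "v \<notin> insert a C" "N v \<inter> insert a C \<noteq> {}"
  show "card (N v \<inter> (V - insert a C)) < card (N v \<inter> insert a C)"
  proof (cases "v = b")
    case True
    then show ?thesis using assms(2) by (simp add: K2_component_def)
  next
    case False
    then have "N v \<inter> C \<noteq> {}" using v N_a by auto
    then have "card (N v \<inter> (V - C)) < card (N v \<inter> C)"
      using assms(1) v(1) by (simp add: indep_offensive_alliance_iff)
    then show ?thesis by (rule degree_mono[rotated]) auto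
  qed
qed

lemma ioa_swap_K2:
  assumes "ioa A" "K2_component a b" "a \<in> A"
  shows "b \<notin> A" and "ioa (insert b (A - {a}))"
proof -
  show "b \<notin> A" using assms by (auto simp: indep_offensive_alliance_iff K2_component_def)
  have "ioa (A - {a})"
    by (rule ioa_remove_K2[of a _ b]) (use assms in \<open>simp_all add: insert_absorb\<close>)
  then show "ioa (insert b (A - {a}))"
    by (rule ioa_insert_K2[OF _ K2_component_sym[OF assms(2)]]) simp
qed

text \<open>Both ends must be alliances, so that a nonempty chain of such steps stays within
  alliances throughout.\<close>

definition grow :: "'a set \<Rightarrow> 'a set \<Rightarrow> bool" where
  "grow A B \<longleftrightarrow> ioa A \<and> ioa B \<and> (\<exists>v. v \<notin> A \<and> B = insert v A)"

definition jump :: "'a set \<Rightarrow> 'a set \<Rightarrow> bool" where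
  "jump A B \<longleftrightarrow> ioa A \<and> ioa B \<and> TJ_step A B"

section \<open>Simulating jumps by additions and removals\<close>

lemma jump_insert:
  assumes "ioa (insert a C)" "ioa (insert b C)" "a \<notin> C" "b \<notin> C" "a \<noteq> b"
  shows "jump (insert a C) (insert b C)"
proof -
  have "insert a C - insert b C = {a}" using assms by auto
  moreover have "finite C" using ioa_finite[OF assms(1)] by simp
  ultimately show ?thesis using assms by (simp add: jump_def TJ_step_def)
qed

lemma jumpE:
  assumes "jump A B"
  obtains a b C where "A = insert a C" "B = insert b C" "a \<notin> C" "b \<notin> C" "a \<noteq> b"
proof -
  have fin: "finite A" "finite B" using assms ioa_finite by (auto simp: jump_def)
  have "card A = card B" "card (A - B) = 1" using assms by (auto simp: jump_def TJ_step_def)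
  \<comment> \<open>\<open>TJ_step\<close> bounds only \<open>A - B\<close>; equal cardinalities
    carry this over to \<open>B - A\<close>.\<close>
  moreover from this have "card (B - A) = 1"
    using card_le_sym_Diff[OF fin] card_le_sym_Diff[OF fin(2,1)] by simp
  ultimately obtain a b where "A - B = {a}" "B - A = {b}" by (auto simp: card_1_singleton_iff)
  then show ?thesis by (intro that[of a "A \<inter> B" b]) blast+
qed

lemma jump_imp_TAR:
  assumes "jump A B" "card A = k"
  defines "Q \<equiv> \<lambda>A. ioa A \<and> card A \<le> k + 1"
  shows "(\<lambda>X Y. Q X \<and> Q Y \<and> TAR_step X Y)\<^sup>*\<^sup>* A B"
proof -
  from assms(1) obtain a b C where C: "A = insert a C" "B = insert b C" "a \<notin> C" "b \<notin> C" "a \<noteq> b"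
    by (rule jumpE)
  have ioas: "ioa A" "ioa B" and "card B = k" using assms by (auto simp: jump_def TJ_step_def)
  have "finite C" using ioa_finite[OF ioas(1)] C(1) by simp
  have "ioa (insert a (insert b C)) \<or> K2_component a b"
    using ioa_insert2_or_K2 ioas C by blast
  \<comment> \<open>\<open>M\<close> is the union of \<open>A\<close> and \<open>B\<close>, with
    \<open>k + 1\<close> vertices, or their intersection, with one vertex fewer than
    \<open>k\<close>.\<close>
  then obtain M where "Q M" "TAR_step A M" "TAR_step M B"
  proof
    assume *: "ioa (insert a (insert b C))"
    show thesis
    proof (rule that[of "insert a (insert b C)"])
      show "Q (insert a (insert b C))"
        using * C \<open>finite C\<close> assms(2) by (simp add: Q_def)
      have "insert a (insert b C) = insert b A" "insert a (insert b C) = insert a B"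
        and "b \<notin> A" "a \<notin> B"
        using C by auto
      then show "TAR_step A (insert a (insert b C))" "TAR_step (insert a (insert b C)) B"
        unfolding TAR_step_def by blast+
    qed
  next
    assume "K2_component a b"
    then have "ioa C" using ioa_remove_K2 ioas(1) C by blast
    show thesis
    proof (rule that[of C])
      show "Q C" using \<open>ioa C\<close> C \<open>finite C\<close> assms(2) by (simp add: Q_def)
      show "TAR_step A C" "TAR_step C B" using C unfolding TAR_step_def by blast+
    qed
  qed
  moreover have "Q A" "Q B" using ioas \<open>card B = k\<close> assms(2) by (simp_all add: Q_def)
  ultimately show ?thesis
    by (intro converse_rtranclp_into_rtranclp[of _ A M] r_into_rtranclp) simp_all
qed

section \<open>Simulating additions and removals by jumps\<close>

lemma grow_swap_K2:
  assumes "grow\<^sup>*\<^sup>* A B" "ioa A" "K2_component a b" "a \<in> A"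
  shows "grow\<^sup>*\<^sup>* (insert b (A - {a})) (insert b (B - {a})) \<and> ioa B \<and> a \<in> B"
  using assms(1)
proof (induction rule: rtranclp_induct)
  case base
  then show ?case using assms by simp
next
  case (step B C)
  then obtain v where v: "ioa C" "v \<notin> B" "C = insert v B" by (auto simp: grow_def)
  then have "a \<in> C" "v \<noteq> a" using step.IH by auto
  \<comment> \<open>Every set of the chain contains \<open>a\<close>, so its neighbour
    \<open>b\<close> is never added and the exchange keeps each addition genuine.\<close>
  moreover have "v \<noteq> b" using ioa_swap_K2(1)[OF v(1) assms(3)] v \<open>a \<in> C\<close> by auto
  ultimately have "v \<notin> insert b (B - {a})" "insert b (C - {a}) = insert v (insert b (B - {a}))"
    using v by auto
  then have "grow (insert b (B - {a})) (insert b (C - {a}))"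
    unfolding grow_def using ioa_swap_K2(2) assms(3) step.IH v(1) \<open>a \<in> C\<close> by blast
  then show ?case using step.IH v \<open>a \<in> C\<close> by auto
qed

lemma grow_subset: "grow\<^sup>*\<^sup>* A B \<Longrightarrow> A \<subseteq> B"
  by (induction rule: rtranclp_induct) (auto simp: grow_def)

text \<open>The chain must be nonempty: jumps preserve size, so \<open>T\<close> has to give up a
  vertex when \<open>b\<close> enters. The induction climbs the chain from \<open>B\<close>.\<close>

lemma grow_insert:
  assumes "grow\<^sup>+\<^sup>+ B T" "b \<notin> B" "ioa (insert b B)"
  shows "\<exists>T'. grow\<^sup>*\<^sup>* (insert b B) T' \<and> jump\<^sup>*\<^sup>* T T'"
  using assms
proof (induction rule: converse_tranclp_induct)
  case (base B)
  then obtain c where c: "ioa T" "c \<notin> B" "T = insert c B" by (auto simp: grow_def)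
  have "jump\<^sup>*\<^sup>* T (insert b B)"
    using jump_insert[of c B b] c base by (cases "b = c") auto
  then show ?case by blast
next
  case (step B C)
  then obtain c where c: "ioa B" "ioa C" "c \<notin> B" "C = insert c B" by (auto simp: grow_def)
  show ?case
  proof (cases "b = c")
    case True
    then show ?thesis using c tranclp_into_rtranclp[OF step.hyps(2)] by blast
  next
    case False
    have "ioa (insert b C) \<or> K2_component b c"
      using ioa_insert2_or_K2[of b B c] c step.prems by blast
    then show ?thesis
    proof
      assume *: "ioa (insert b C)"
      then obtain T' where T': "grow\<^sup>*\<^sup>* (insert b C) T'" "jump\<^sup>*\<^sup>* T T'"
        using step.IH c step.prems False by auto
      have "grow (insert b B) (insert b C)"
        unfolding grow_def using * step.prems c False by (auto intro!: exI[of _ c])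
      then show ?thesis using T' by (meson converse_rtranclp_into_rtranclp)
    next
      assume "K2_component b c"
      then have K2: "K2_component c b" by (rule K2_component_sym)
      have CT: "grow\<^sup>*\<^sup>* C T" using step.hyps(2) by simp
      \<comment> \<open>Exchanging \<open>c\<close> for \<open>b\<close> throughout the chain from
        \<open>C\<close> to \<open>T\<close> turns its lowest set into \<open>insert b B\<close>, so
        the addition of \<open>c\<close> drops out and the top set makes a single jump.\<close>
      let ?T' = "insert b (T - {c})"
      have "c \<in> C" using c by simp
      note swap = grow_swap_K2[OF CT c(2) K2 \<open>c \<in> C\<close>]
      have "C - {c} = B" using c by auto
      then have "grow\<^sup>*\<^sup>* (insert b B) ?T'" using swap by simp
      moreover have "jump T ?T'"
        using jump_insert[of c "T - {c}" b] swap ioa_swap_K2[of T c b] K2 False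
        by (simp add: insert_absorb)
      ultimately show ?thesis by blast
    qed
  qed
qed

lemma jump_card: "jump\<^sup>*\<^sup>* A B \<Longrightarrow> card B = card A"
  by (induction rule: rtranclp_induct) (auto simp: jump_def TJ_step_def)

lemma jump_ioa: "jump\<^sup>*\<^sup>* A B \<Longrightarrow> ioa A \<Longrightarrow> ioa B"
  by (induction rule: rtranclp_induct) (auto simp: jump_def)

text \<open>The invariant of the simulation. The disjunct \<open>grow T B\<close> covers current
  sets with \<open>k + 1\<close> vertices, which cannot lie below a set of size
  \<open>k\<close>.\<close>

lemma TAR_imp_jump:
  fixes k :: nat
  assumes S: "ioa S" "card S = k"
  defines "Q \<equiv> \<lambda>A. ioa A \<and> card A \<le> k + 1"
  assumes "(\<lambda>X Y. Q X \<and> Q Y \<and> TAR_step X Y)\<^sup>*\<^sup>* S B"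
  shows "\<exists>T. jump\<^sup>*\<^sup>* S T \<and> (grow\<^sup>*\<^sup>* B T \<or> grow T B)"
  using assms(4)
proof (induction rule: rtranclp_induct)
  case base
  then show ?case by blast
next
  case (step B C)
  then obtain T where T: "jump\<^sup>*\<^sup>* S T" "grow\<^sup>*\<^sup>* B T \<or> grow T B" by blast
  have ioas: "ioa B" "ioa C" "ioa T" and "card C \<le> k + 1" "card T = k"
    using step.hyps(2) jump_ioa[OF T(1) S(1)] jump_card[OF T(1)] S(2) by (auto simp: Q_def)
  have fin: "finite B" "finite T" using ioas ioa_finite by auto
  from step.hyps(2) consider (add) v where "v \<notin> B" "C = insert v B"
    | (remove) v where "v \<notin> C" "B = insert v C"
    by (auto simp: TAR_step_def)
  then show ?case
  proof cases
    case add
    \<comment> \<open>Otherwise \<open>B\<close> has \<open>k + 1\<close> vertices already and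
      \<open>C\<close> would exceed the threshold.\<close>
    have "\<not> grow T B"
      using add \<open>card C \<le> k + 1\<close> \<open>card T = k\<close> fin by (auto simp: grow_def)
    then consider "B = T" | "grow\<^sup>+\<^sup>+ B T" using T(2) by (meson rtranclpD)
    then show ?thesis
    proof cases
      case 1
      then have "grow T C" using add ioas by (auto simp: grow_def)
      then show ?thesis using T(1) by blast
    next
      case 2
      then obtain T' where "grow\<^sup>*\<^sup>* C T'" "jump\<^sup>*\<^sup>* T T'"
        using grow_insert[of B T v] add ioas by blast
      then show ?thesis using T(1) by (meson rtranclp_trans)
    qed
  next
    case remove
    then have "grow C B" using ioas by (auto simp: grow_def)
    from T(2) show ?thesis
    proof
      assume "grow\<^sup>*\<^sup>* B T"
      then show ?thesis using \<open>grow C B\<close> T(1) by (meson converse_rtranclp_into_rtranclp)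
    next
      assume "grow T B"
      then obtain w where w: "w \<notin> T" "B = insert w T" by (auto simp: grow_def)
      show ?thesis
      proof (cases "w = v")
        case True
        then have "C = T" using w remove by auto
        then show ?thesis using T(1) by blast
      next
        case False
        \<comment> \<open>\<open>T\<close> and \<open>C\<close> both arise from \<open>B\<close> by
          deleting one vertex, so moving the token from \<open>v\<close> to \<open>w\<close> makes
          the new top set \<open>C\<close> itself.\<close>
        have "T = insert v (B - {v, w})" "C = insert w (B - {v, w})"
          using w remove False by auto
        then have "jump T C"
          using jump_insert[of v "B - {v, w}" w] ioas False by simp
        then show ?thesis using T(1) by (meson rtranclp.rtrancl_into_rtrancl rtranclp.rtrancl_refl)
      qed
    qed
  qed
qed

theorem jump_iff_TAR:
  fixes k :: nat
  assumes "ioa S" "card S = k" "card T = k"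
  defines "Q \<equiv> \<lambda>A. ioa A \<and> card A \<le> k + 1"
  shows "jump\<^sup>*\<^sup>* S T \<longleftrightarrow> (\<lambda>X Y. Q X \<and> Q Y \<and> TAR_step X Y)\<^sup>*\<^sup>* S T" (is "_ \<longleftrightarrow> ?R\<^sup>*\<^sup>* S T")
proof
  assume "jump\<^sup>*\<^sup>* S T"
  then show "?R\<^sup>*\<^sup>* S T"
  proof (induction rule: rtranclp_induct)
    case (step A B)
    have "card A = k" using jump_card[OF step.hyps(1)] assms(2) by simp
    then have "?R\<^sup>*\<^sup>* A B" unfolding Q_def using jump_imp_TAR step.hyps(2) by blast
    then show ?case using step.IH by (meson rtranclp_trans)
  qed simp
next
  assume "?R\<^sup>*\<^sup>* S T"
  then obtain U where U: "jump\<^sup>*\<^sup>* S U" "grow\<^sup>*\<^sup>* T U \<or> grow U T"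
    using TAR_imp_jump[OF assms(1,2)] unfolding Q_def by blast
  then have "card U = k" "finite U"
    using jump_card jump_ioa ioa_finite assms by metis+
  \<comment> \<open>As \<open>T\<close> and \<open>U\<close> both have size \<open>k\<close>,
    neither can lie strictly below the other, which forces \<open>T = U\<close>.\<close>
  moreover from this have "\<not> grow U T" using assms(3) by (auto simp: grow_def)
  ultimately have "T = U"
    using U(2) grow_subset assms(3) by (metis card_subset_eq)
  then show "jump\<^sup>*\<^sup>* S T" using U by simp
qed

text \<open>The predicate \<open>P\<close> lets one statement serve both models: it is trivial for
  jumps and the size bound for additions and removals.\<close>

lemma ex_ioa_sequence_iff:
  assumes "ioa A"
  shows "(\<exists>As. ioa_sequence step V E As \<and> from_to A B As \<and> (\<forall>X\<in>set As. P X)) \<longleftrightarrow>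
    P A \<and> (\<lambda>X Y. (ioa X \<and> P X) \<and> (ioa Y \<and> P Y) \<and> step X Y)\<^sup>*\<^sup>* A B"
proof -
  have "(\<exists>As. ioa_sequence step V E As \<and> from_to A B As \<and> (\<forall>X\<in>set As. P X)) \<longleftrightarrow>
    (\<exists>As. As \<noteq> [] \<and> hd As = A \<and> last As = B \<and> (\<forall>X\<in>set As. ioa X \<and> P X) \<and> successively step As)"
    unfolding ioa_sequence_def from_to_def successively_conv_nth by blast
  then show ?thesis
    using assms unfolding ex_list_successively_iff_rtranclp by simp
qed

end

theorem theorem4:
  fixes V :: "'a set" and E :: "'a set set" and A_s A_t :: "'a set" and k :: nat
  assumes "finite_simple_graph V E"
    and "indep_offensive_alliance V E A_s"
    and "indep_offensive_alliance V E A_t"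
    and "card A_s = k" and "card A_t = k"
  shows "(\<exists>As. ioa_sequence TJ_step V E As \<and> from_to A_s A_t As) \<longleftrightarrow>
         (\<exists>As. ioa_sequence TAR_step V E As \<and> from_to A_s A_t As \<and> has_threshold (k + 1) As)"
proof -
  interpret fin_graph V E by standard (fact assms(1))
  have "(\<exists>As. ioa_sequence TJ_step V E As \<and> from_to A_s A_t As) \<longleftrightarrow> jump\<^sup>*\<^sup>* A_s A_t"
    using ex_ioa_sequence_iff[OF assms(2), of TJ_step A_t "\<lambda>_. True"] by (simp flip: jump_def)
  also have "\<dots> \<longleftrightarrow>
    (\<exists>As. ioa_sequence TAR_step V E As \<and> from_to A_s A_t As \<and> has_threshold (k + 1) As)"
    using ex_ioa_sequence_iff[OF assms(2), of TAR_step A_t "\<lambda>X. card X \<le> k + 1"]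
      jump_iff_TAR[OF assms(2,4,5)] assms(4)
    by (simp add: has_threshold_def)
  finally show ?thesis .
qed

end
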